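(* If $|A|=1$, then the inequational theory of BCCS($A$) modulo $\precsim_{\rm WIF}$ does not have a finite basis; that is, there is no finite inequational axiomatization over BCCS($A$) that is sound modulo $\precsim_{\rm WIF}$, ground-complete for BCCS($A$) modulo $\precsim_{\rm WIF}$, and $\omega$-complete.
   Context: $A$ is a nonempty set of actions, $\tau\notin A$, $A_\tau=A\cup\{\tau\}$. BCCS($A$) terms: $t::=0\mid x\mid\alpha t\mid t+t$ ($x$ a variable, $\alpha\in A_\tau$). Transitions: $\alpha t\xrightarrow{\alpha}t$; if $t\xrightarrow{\alpha}t'$ then $t+u\xrightarrow{\alpha}t'$ and $u+t\xrightarrow{\alpha}t'$. $\Rightarrow$ is the reflexive-transitive closure of $\xrightarrow{\tau}$. $a_1\cdots a_k\in A^*$ is a weak trace of closed $s$ if $s\Rightarrow\xrightarrow{a_1}\Rightarrow\cdots\xrightarrow{a_k}\Rightarrow s'$; $\mathcal{WT}(s)$ the set. $(a_1\cdots a_k,B)$, $B\subseteq A^*$, is a weak impossible future of $s$ if $s\Rightarrow\xrightarrow{a_1}\Rightarrow\cdots\xrightarrow{a_k}\Rightarrow s'$ with $\mathcal{WT}(s')\cap B=\emptyset$. $s_1\precsim_{\rm WIF}s_2$ iff weak impossible futures of $s_1$ are those of $s_2$, $\mathcal{WT}(s_1)=\mathcal{WT}(s_2)$, and $s_1\xrightarrow{\tau}$ implies $s_2\xrightarrow{\tau}$; on open terms via all closed substitutions. Inequational logic: reflexivity, transitivity, substitution instances, closure under contexts. Sound: every derivable inequation holds modulo $\precsim_{\rm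 WIF}$; ground-complete: closed $p\precsim_{\rm WIF}q$ implies $p\preccurlyeq q$ derivable; $\omega$-complete: if all closed instances of $t\preccurlyeq u$ are derivable, then so is $t\preccurlyeq u$. *)

theory Defs
  imports Main "HOL-Library.Cardinality"
begin

text \<open>The nonempty set \<open>A\<close> of visible actions is the type \<^typ>\<open>'a\<close>, and
  \<open>'a act\<close> is \<open>A \<union> {\<tau>}\<close>.\<close>

datatype 'a act = Tau | Act 'a

datatype (actions: 'a, vars: 'v) bccs =
    Stop
  | Var 'v
  | Prefix "'a act" "('a, 'v) bccs"
  | Plus "('a, 'v) bccs" "('a, 'v) bccs"

definition closed_term :: "('a, 'v) bccs \<Rightarrow> bool" where
  "closed_term t \<longleftrightarrow> vars t = {}"

primrec subst :: "('v \<Rightarrow> ('a, 'w) bccs) \<Rightarrow> ('a, 'v) bccs \<Rightarrow> ('a, 'w) bccs" where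
  "subst \<sigma> Stop = Stop"
| "subst \<sigma> (Var x) = \<sigma> x"
| "subst \<sigma> (Prefix \<alpha> t) = Prefix \<alpha> (subst \<sigma> t)"
| "subst \<sigma> (Plus t u) = Plus (subst \<sigma> t) (subst \<sigma> u)"

definition closed_subst :: "('v \<Rightarrow> ('a, 'w) bccs) \<Rightarrow> bool" where
  "closed_subst \<sigma> \<longleftrightarrow> (\<forall>x. closed_term (\<sigma> x))"

inductive step :: "('a, 'v) bccs \<Rightarrow> 'a act \<Rightarrow> ('a, 'v) bccs \<Rightarrow> bool" where
  step_prefix: "step (Prefix \<alpha> t) \<alpha> t"
| step_plus_left: "step t \<alpha> t' \<Longrightarrow> step (Plus t u) \<alpha> t'"
| step_plus_right: "step t \<alpha> t' \<Longrightarrow> step (Plus u t) \<alpha> t'"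

definition tau_steps :: "('a, 'v) bccs \<Rightarrow> ('a, 'v) bccs \<Rightarrow> bool" where
  "tau_steps = (\<lambda>s t. step s Tau t)\<^sup>*\<^sup>*"

primrec weak_steps :: "('a, 'v) bccs \<Rightarrow> 'a list \<Rightarrow> ('a, 'v) bccs \<Rightarrow> bool" where
  "weak_steps s [] s' \<longleftrightarrow> tau_steps s s'"
| "weak_steps s (a # w) s' \<longleftrightarrow>
     (\<exists>s1 s2. tau_steps s s1 \<and> step s1 (Act a) s2 \<and> weak_steps s2 w s')"

definition weak_traces :: "('a, 'v) bccs \<Rightarrow> 'a list set" where
  "weak_traces s = {w. \<exists>s'. weak_steps s w s'}"

definition weak_impossible_futures :: "('a, 'v) bccs \<Rightarrow> ('a list \<times> 'a list set) set" where
  "weak_impossible_futures s =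
     {(w, B). \<exists>s'. weak_steps s w s' \<and> weak_traces s' \<inter> B = {}}"

text \<open>Intended for closed terms only: \<^const>\<open>step\<close> treats variables as deadlocks.\<close>

definition wif_closed :: "('a, 'v) bccs \<Rightarrow> ('a, 'v) bccs \<Rightarrow> bool" where
  "wif_closed p q \<longleftrightarrow>
     weak_impossible_futures p \<subseteq> weak_impossible_futures q \<and>
     weak_traces p = weak_traces q \<and>
     ((\<exists>p'. step p Tau p') \<longrightarrow> (\<exists>q'. step q Tau q'))"

definition wif :: "('a, 'v) bccs \<Rightarrow> ('a, 'v) bccs \<Rightarrow> bool" where
  "wif t u \<longleftrightarrow>
     (\<forall>\<sigma> :: 'v \<Rightarrow> ('a, 'v) bccs. closed_subst \<sigma> \<longrightarrow> wif_closed (subst \<sigma> t) (subst \<sigma> u))"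

type_synonym ('a, 'v) axioms = "(('a, 'v) bccs \<times> ('a, 'v) bccs) set"

inductive derivable :: "('a, 'v) axioms \<Rightarrow> ('a, 'v) bccs \<Rightarrow> ('a, 'v) bccs \<Rightarrow> bool"
  for E :: "('a, 'v) axioms" where
  derivable_axiom: "(t, u) \<in> E \<Longrightarrow> derivable E t u"
| derivable_refl: "derivable E t t"
| derivable_trans: "derivable E t u \<Longrightarrow> derivable E u v \<Longrightarrow> derivable E t v"
| derivable_subst: "derivable E t u \<Longrightarrow> derivable E (subst \<sigma> t) (subst \<sigma> u)"
| derivable_prefix: "derivable E t u \<Longrightarrow> derivable E (Prefix \<alpha> t) (Prefix \<alpha> u)"
| derivable_plus_left: "derivable E t u \<Longrightarrow> derivable E (Plus t v) (Plus u v)"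
| derivable_plus_right: "derivable E t u \<Longrightarrow> derivable E (Plus v t) (Plus v u)"

definition sound :: "('a, 'v) axioms \<Rightarrow> bool" where
  "sound E \<longleftrightarrow> (\<forall>t u. derivable E t u \<longrightarrow> wif t u)"

definition ground_complete :: "('a, 'v) axioms \<Rightarrow> bool" where
  "ground_complete E \<longleftrightarrow>
     (\<forall>p q. closed_term p \<and> closed_term q \<and> wif_closed p q \<longrightarrow> derivable E p q)"

definition omega_complete :: "('a, 'v) axioms \<Rightarrow> bool" where
  "omega_complete E \<longleftrightarrow>
     (\<forall>t u. (\<forall>\<sigma> :: 'v \<Rightarrow> ('a, 'v) bccs.
               closed_subst \<sigma> \<longrightarrow> derivable E (subst \<sigma> t) (subst \<sigma> u)) \<longrightarrow>
            derivable E t u)"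

end

theory Submission
  imports Defs
begin

text \<open>The inequations \<open>a\<^sup>m x \<preccurlyeq> a\<^sup>m x + x\<close> with \<open>m \<ge> 1\<close> are all valid when \<open>a\<close> is the only
  action, so they would be derivable from a sound, ground-complete and \<open>\<omega>\<close>-complete axiomatization.
  Let the levels of \<open>x\<close> in \<open>t\<close> be the numbers of visible prefixes above the occurrences of \<open>x\<close>.
  Substituting long sequences \<open>a\<^sup>n\<close> for \<open>x\<close> shows that a valid \<open>t \<preccurlyeq> u\<close> can only enlarge the set
  of levels, and that every variable of level \<open>0\<close> in \<open>u\<close> occurs in \<open>t\<close>. Hence, when an axiom of
  size below \<open>m\<close> creates a new occurrence of \<open>x\<close> at level \<open>0\<close>, its left-hand side already has
  \<open>x\<close> at some level strictly between \<open>0\<close> and \<open>m\<close>, and this level survives up to the right-hand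
  side \<open>a\<^sup>m x + x\<close>, whose levels are \<open>0\<close> and \<open>m\<close> only.\<close>

section \<open>Levels of variables and substitution\<close>

abbreviation act_pow :: "'a \<Rightarrow> nat \<Rightarrow> ('a, 'v) bccs \<Rightarrow> ('a, 'v) bccs" where
  "act_pow a n \<equiv> Prefix (Act a) ^^ n"

text \<open>\<open>Tau\<close> leaves levels unchanged because weak traces do not record it.\<close>

primrec levels :: "'v \<Rightarrow> ('a, 'v) bccs \<Rightarrow> nat set" where
  "levels x Stop = {}"
| "levels x (Var y) = (if x = y then {0} else {})"
| "levels x (Prefix \<alpha> t) = (case \<alpha> of Tau \<Rightarrow> levels x t | Act a \<Rightarrow> Suc ` levels x t)"
| "levels x (Plus t u) = levels x t \<union> levels x u"

lemma levels_subst: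
  "k \<in> levels x (subst \<sigma> t) \<longleftrightarrow>
     (\<exists>y i j. i \<in> levels y t \<and> j \<in> levels x (\<sigma> y) \<and> k = i + j)"
proof (induction t arbitrary: k)
  case (Prefix \<alpha> t)
  show ?case
  proof (cases \<alpha>)
    case Tau
    then show ?thesis using Prefix by simp
  next
    case (Act a)
    have "k \<in> levels x (subst \<sigma> (Prefix \<alpha> t)) \<longleftrightarrow>
        (\<exists>k'. k = Suc k' \<and> k' \<in> levels x (subst \<sigma> t))"
      using Act by auto
    also have "\<dots> \<longleftrightarrow> (\<exists>y i j. i \<in> levels y (Prefix \<alpha> t) \<and> j \<in> levels x (\<sigma> y) \<and> k = i + j)"
      unfolding Prefix using Act by fastforce
    finally show ?thesis .
  qed
next
  case (Plus t u)
  show ?case unfolding subst.simps levels.simps Un_iff Plus by blast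
qed auto

lemma levels_le_size: "k \<in> levels x t \<Longrightarrow> k \<le> size t"
  by (induction t arbitrary: k) (fastforce split: if_splits act.splits)+

lemma levels_act_pow: "levels x (act_pow a n t) = (+) n ` levels x t"
  by (induction n) (auto simp: image_iff)

lemma subst_subst: "subst \<rho> (subst \<sigma> t) = subst (\<lambda>y. subst \<rho> (\<sigma> y)) t"
  by (induction t) auto

lemma subst_act_pow: "subst \<sigma> (act_pow a n t) = act_pow a n (subst \<sigma> t)"
  by (induction n) auto

lemma vars_act_pow: "vars (act_pow a n t) = vars t"
  by (induction n) auto

section \<open>Weak steps and weak traces of the term constructors\<close>

lemma step_Stop: "\<not> step Stop \<alpha> t"
  by (auto elim: step.cases)

lemma step_Prefix_iff: "step (Prefix \<alpha> t) \<beta> u \<longleftrightarrow> \<beta> = \<alpha> \<and> u = t"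
  by (auto elim: step.cases intro: step.intros)

lemma step_Plus_iff: "step (Plus t u) \<alpha> v \<longleftrightarrow> step t \<alpha> v \<or> step u \<alpha> v"
  by (auto elim: step.cases intro: step.intros)

lemma tau_steps_refl: "tau_steps s s"
  by (simp add: tau_steps_def)

lemma tau_steps_iff: "tau_steps s s' \<longleftrightarrow> s' = s \<or> (\<exists>s1. step s Tau s1 \<and> tau_steps s1 s')"
  unfolding tau_steps_def
  by (auto elim: converse_rtranclpE intro: converse_rtranclp_into_rtranclp)

lemma tau_steps_Stop: "tau_steps Stop s \<longleftrightarrow> s = Stop"
  by (subst tau_steps_iff) (simp add: step_Stop)

lemma tau_steps_Prefix_Act: "tau_steps (Prefix (Act a) t) s \<longleftrightarrow> s = Prefix (Act a) t"
  by (subst tau_steps_iff) (simp add: step_Prefix_iff)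

lemma tau_steps_Prefix_Tau:
  "tau_steps (Prefix Tau t) s \<longleftrightarrow> s = Prefix Tau t \<or> tau_steps t s"
  by (subst tau_steps_iff) (simp add: step_Prefix_iff)

lemma weak_steps_Stop: "weak_steps Stop w s \<longleftrightarrow> w = [] \<and> s = Stop"
  by (cases w) (auto simp: tau_steps_Stop step_Stop)

lemma weak_steps_Prefix_Act:
  "weak_steps (Prefix (Act a) t) w s \<longleftrightarrow>
     w = [] \<and> s = Prefix (Act a) t \<or> (\<exists>v. w = a # v \<and> weak_steps t v s)"
  by (cases w) (auto simp: tau_steps_Prefix_Act step_Prefix_iff)

lemma weak_steps_Prefix_Tau:
  "weak_steps (Prefix Tau t) w s \<longleftrightarrow> w = [] \<and> s = Prefix Tau t \<or> weak_steps t w s"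
  by (cases w) (auto simp: tau_steps_Prefix_Tau step_Prefix_iff)

text \<open>The empty word must be excluded: it lets a sum stay where it is, a state that neither
  summand need reach.\<close>

lemma weak_steps_Plus:
  assumes "w \<noteq> []"
  shows "weak_steps (Plus t u) w s \<longleftrightarrow> weak_steps t w s \<or> weak_steps u w s"
proof -
  obtain b v where w: "w = b # v" using assms by (cases w) auto
  \<comment> \<open>A sum vanishes with its first transition, be it \<open>Tau\<close> or
    \<open>Act b\<close>, so the run is split there and \<open>step_Plus_iff\<close> decides the
    summand.\<close>
  have first: "(\<exists>s1. tau_steps r s1 \<and> step s1 (Act b) s2) \<longleftrightarrow>
      step r (Act b) s2 \<or> (\<exists>r1. step r Tau r1 \<and> (\<exists>s1. tau_steps r1 s1 \<and> step s1 (Act b) s2))"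
    for r s2 :: "('a, 'b) bccs"
    by (subst tau_steps_iff) blast
  have "(\<exists>s1. tau_steps (Plus t u) s1 \<and> step s1 (Act b) s2) \<longleftrightarrow>
      (\<exists>s1. tau_steps t s1 \<and> step s1 (Act b) s2) \<or> (\<exists>s1. tau_steps u s1 \<and> step s1 (Act b) s2)"
    for s2
    by (subst (1 2 3) first) (auto simp: step_Plus_iff)
  then show ?thesis unfolding w weak_steps.simps by blast
qed

lemma weak_steps_act_pow_Stop:
  "weak_steps (act_pow a n Stop) w s \<longleftrightarrow>
     (\<exists>j\<le>n. w = replicate j a \<and> s = act_pow a (n - j) Stop)"
proof (induction n arbitrary: w)
  case 0
  show ?case by (simp add: weak_steps_Stop)
next
  case (Suc n)
  have ex_le_Suc: "(\<exists>j\<le>Suc n. P j) \<longleftrightarrow> P 0 \<or> (\<exists>j\<le>n. P (Suc j))" for P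
    by (metis Suc_le_mono le0 not0_implies_Suc)
  have "weak_steps (act_pow a (Suc n) Stop) w s \<longleftrightarrow>
      w = [] \<and> s = act_pow a (Suc n) Stop \<or>
      (\<exists>j\<le>n. w = replicate (Suc j) a \<and> s = act_pow a (n - j) Stop)"
    by (simp add: weak_steps_Prefix_Act Suc) blast
  also have "\<dots> \<longleftrightarrow> (\<exists>j\<le>Suc n. w = replicate j a \<and> s = act_pow a (Suc n - j) Stop)"
    unfolding ex_le_Suc by simp
  finally show ?case .
qed

lemma weak_steps_append: "weak_steps s (v @ w) s' \<Longrightarrow> \<exists>s''. weak_steps s v s''"
proof (induction v arbitrary: s)
  case Nil
  show ?case by (rule exI[of _ s]) (simp add: tau_steps_refl)
next
  case (Cons b v)
  then show ?case by fastforce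
qed

lemma Nil_in_weak_traces: "[] \<in> weak_traces s"
  unfolding weak_traces_def by (simp add: exI[of _ s] tau_steps_refl)

lemma weak_traces_Plus: "weak_traces (Plus t u) = weak_traces t \<union> weak_traces u"
proof (rule set_eqI)
  fix w
  show "w \<in> weak_traces (Plus t u) \<longleftrightarrow> w \<in> weak_traces t \<union> weak_traces u"
  proof (cases "w = []")
    case True
    then show ?thesis by (simp add: Nil_in_weak_traces)
  next
    case False
    then show ?thesis by (auto simp: weak_traces_def weak_steps_Plus)
  qed
qed

lemma weak_traces_Stop: "weak_traces Stop = {[]}"
  by (auto simp: weak_traces_def weak_steps_Stop)

section \<open>Probing the levels of one variable with long sequences\<close>

definition probe :: "'a \<Rightarrow> 'v \<Rightarrow> nat \<Rightarrow> 'v \<Rightarrow> ('a, 'v) bccs" where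
  "probe a x n = (\<lambda>y. if y = x then act_pow a n Stop else Stop)"

lemma closed_subst_probe: "closed_subst (probe a x n)"
  by (simp add: closed_subst_def closed_term_def probe_def vars_act_pow)

text \<open>Run down to the occurrence of \<open>x\<close> and then through the whole copy of
  \<open>act_pow a n Stop\<close>. The bound on \<open>n\<close> keeps the word nonempty, as the
  case of a sum requires.\<close>

lemma weak_steps_probe_if_level:
  assumes "k \<in> levels x t" and "n \<ge> 1"
  shows "\<exists>w. length w = k + n \<and> weak_steps (subst (probe a x n) t) w Stop"
  using assms(1)
proof (induction t arbitrary: k)
  case Stop
  then show ?case by simp
next
  case (Var y)
  then have "k = 0" "y = x" by (auto split: if_splits)
  then show ?case
    by (intro exI[of _ "replicate n a"]) (auto simp: probe_def weak_steps_act_pow_Stop)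
next
  case (Prefix \<alpha> t)
  show ?case
  proof (cases \<alpha>)
    case Tau
    then show ?thesis using Prefix by (auto simp: weak_steps_Prefix_Tau)
  next
    case (Act b)
    then obtain k' where k': "k = Suc k'" "k' \<in> levels x t" using Prefix.prems by auto
    obtain w where "length w = k' + n" "weak_steps (subst (probe a x n) t) w Stop"
      using Prefix.IH[OF k'(2)] by blast
    then show ?thesis
      by (intro exI[of _ "b # w"]) (simp add: Act k' weak_steps_Prefix_Act del: weak_steps.simps)
  qed
next
  case (Plus t u)
  then obtain r w where "r = t \<or> r = u" "length w = k + n"
    and "weak_steps (subst (probe a x n) r) w Stop"
    by auto metis+
  moreover have "w \<noteq> []" using \<open>length w = k + n\<close> assms(2) by auto
  ultimately show ?case by (auto simp: weak_steps_Plus)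
qed

text \<open>A weak trace that is too long for \<open>t\<close> itself must end inside a copy of \<open>a\<^sup>n\<close>.\<close>

lemma level_if_long_weak_steps_probe:
  assumes "weak_steps (subst (probe a x n) t) w s" and "size t < length w"
  shows "\<exists>k\<in>levels x t. \<exists>j\<le>n. length w = k + j \<and> s = act_pow a (n - j) Stop"
  using assms
proof (induction t arbitrary: w)
  case Stop
  then show ?case by (simp add: weak_steps_Stop)
next
  case (Var y)
  then show ?case
    by (cases "y = x") (auto simp: probe_def weak_steps_act_pow_Stop weak_steps_Stop)
next
  case (Prefix \<alpha> t)
  show ?case
  proof (cases \<alpha>)
    case Tau
    then have "weak_steps (subst (probe a x n) t) w s"
      using Prefix.prems by (auto simp: weak_steps_Prefix_Tau)
    then show ?thesis using Prefix.IH[of w] Prefix.prems(2) Tau by simp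
  next
    case (Act b)
    then obtain v where v: "w = b # v" "weak_steps (subst (probe a x n) t) v s"
      using Prefix.prems by (auto simp: weak_steps_Prefix_Act)
    then show ?thesis using Prefix.IH[of v] Prefix.prems(2) Act by auto
  qed
next
  case (Plus t u)
  have "w \<noteq> []" using Plus.prems(2) by auto
  then have "weak_steps (subst (probe a x n) t) w s \<or> weak_steps (subst (probe a x n) u) w s"
    using Plus.prems(1) by (simp add: weak_steps_Plus)
  then show ?case using Plus.IH[of w] Plus.prems(2) by auto
qed

section \<open>Levels in valid inequations and along derivations\<close>

lemma wif_probe:
  "wif t u \<Longrightarrow> wif_closed (subst (probe a x n) t) (subst (probe a x n) u)"
  by (simp add: wif_def closed_subst_probe)

lemma wif_levels_subset:
  assumes "wif t (u :: ('a, 'v) bccs)"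
  shows "levels x t \<subseteq> levels x u"
proof
  fix k assume k: "k \<in> levels x t"
  fix a :: 'a
  \<comment> \<open>With this \<open>n\<close> every word of length \<open>k + n\<close> is too long
    for \<open>u\<close> itself.\<close>
  define n where "n = Suc (size u)"
  obtain w where w: "length w = k + n" "weak_steps (subst (probe a x n) t) w Stop"
    using weak_steps_probe_if_level[OF k, of n a] n_def by auto
  then have "(w, {[a]}) \<in> weak_impossible_futures (subst (probe a x n) t)"
    by (auto simp: weak_impossible_futures_def weak_traces_Stop)
  then have "(w, {[a]}) \<in> weak_impossible_futures (subst (probe a x n) u)"
    using wif_probe[OF assms, of a x n] by (auto simp: wif_closed_def)
  then obtain s where s: "weak_steps (subst (probe a x n) u) w s" "[a] \<notin> weak_traces s"
    by (auto simp: weak_impossible_futures_def)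
  have "size u < length w" using w(1) by (simp add: n_def)
  then obtain k' j where kj: "k' \<in> levels x u" "j \<le> n" "length w = k' + j"
      "s = act_pow a (n - j) Stop"
    using level_if_long_weak_steps_probe[OF s(1)] by blast
  \<comment> \<open>A state refusing \<open>[a]\<close> has exhausted its copy of
    \<open>act_pow a n Stop\<close>, which pins the level down to
    \<open>length w - n\<close>.\<close>
  have "j = n"
  proof (rule ccontr)
    assume "j \<noteq> n"
    then have "weak_steps s [a] (act_pow a (n - j - 1) Stop)"
      unfolding kj(4) weak_steps_act_pow_Stop using kj(2) by (intro exI[of _ 1]) auto
    then show False using s(2) by (auto simp: weak_traces_def simp del: weak_steps.simps)
  qed
  then show "k \<in> levels x u" using kj w(1) by simp
qed

text \<open>From \<open>u\<close> back to \<open>t\<close> only the equality of weak traces helps.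
  It reveals that \<open>x\<close> occurs but not at which level, since a trace may stop midway in a
  copy of \<open>act_pow a n Stop\<close>.\<close>

lemma wif_levels_nonempty:
  assumes "wif t (u :: ('a, 'v) bccs)" and "levels x u \<noteq> {}"
  shows "levels x t \<noteq> {}"
proof -
  fix a :: 'a
  define n where "n = Suc (size t)"
  obtain k where "k \<in> levels x u" using assms(2) by blast
  then obtain w where w: "length w = k + n" "weak_steps (subst (probe a x n) u) w Stop"
    using weak_steps_probe_if_level[of k x u n a] n_def by auto
  then have "w \<in> weak_traces (subst (probe a x n) u)"
    by (auto simp: weak_traces_def)
  then have "w \<in> weak_traces (subst (probe a x n) t)"
    using wif_probe[OF assms(1), of a x n] by (auto simp: wif_closed_def)
  then obtain s where "weak_steps (subst (probe a x n) t) w s"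
    by (auto simp: weak_traces_def)
  then show ?thesis
    using level_if_long_weak_steps_probe[of a x n t w s] w(1) n_def by auto
qed

text \<open>The arbitrary \<open>\<sigma>\<close> carries the induction through
  \<open>derivable_subst\<close>, where substitutions compose, and so axioms are met in all their
  instances.\<close>

lemma derivable_level_zero:
  fixes \<sigma> :: "'v \<Rightarrow> ('a, 'v) bccs"
  assumes "derivable E t u" and "sound E" and "\<And>l r. (l, r) \<in> E \<Longrightarrow> size l < m"
    and "levels x (subst \<sigma> u) \<inter> {1..<m} = {}" and "0 \<in> levels x (subst \<sigma> u)"
  shows "0 \<in> levels x (subst \<sigma> t)"
  using assms(1,4,5)
proof (induction arbitrary: \<sigma> rule: derivable.induct)
  case (derivable_axiom l r)
  have "derivable E l r" using derivable_axiom(1) by (rule derivable.derivable_axiom)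
  then have valid: "wif l r" "wif (subst \<sigma> l) (subst \<sigma> r)"
    using assms(2) by (simp_all add: sound_def derivable.derivable_subst)
  \<comment> \<open>Levels add under substitution, so level \<open>0\<close> splits as
    \<open>0 + 0\<close>.\<close>
  obtain y where y: "0 \<in> levels y r" "0 \<in> levels x (\<sigma> y)"
    using derivable_axiom(3) by (auto simp: levels_subst)
  obtain k where k: "k \<in> levels y l" using wif_levels_nonempty[OF valid(1), of y] y(1) by blast
  then have "k < m" using levels_le_size assms(3)[OF derivable_axiom(1)] by fastforce
  have kx: "k \<in> levels x (subst \<sigma> l)" using k y(2) by (force simp: levels_subst)
  then have "k \<in> levels x (subst \<sigma> r)" using wif_levels_subset[OF valid(2)] by blast
  then have "k = 0" using derivable_axiom(2) \<open>k < m\<close> by (cases k) auto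
  then show ?case using kx by simp
next
  case (derivable_trans t u v)
  have "wif (subst \<sigma> u) (subst \<sigma> v)"
    using derivable_trans(2) assms(2) by (simp add: sound_def derivable.derivable_subst)
  \<comment> \<open>The gap in the levels passes back from \<open>v\<close> to \<open>u\<close>, as
    valid inequations only enlarge the set of levels.\<close>
  then have "levels x (subst \<sigma> u) \<inter> {1..<m} = {}"
    using wif_levels_subset[of "subst \<sigma> u"] derivable_trans(5) by blast
  then show ?case using derivable_trans by blast
next
  case (derivable_subst t u \<rho>)
  then show ?case by (simp add: subst_subst)
next
  case (derivable_prefix t u \<alpha>)
  then show ?case by (cases \<alpha>) auto
next
  case (derivable_plus_left t u v)
  then show ?case by (simp add: Int_Un_distrib2) blast
next
  case (derivable_plus_right t u v)
  then show ?case by (simp add: Int_Un_distrib2) blast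
qed auto

section \<open>Valid inequations over a single action\<close>

lemma list_eq_if_card_1:
  fixes v w :: "'a list"
  assumes "CARD('a) = 1" and "length v = length w"
  shows "v = w"
proof -
  obtain c where "UNIV = {c :: 'a}" using assms(1) card_1_singletonE by blast
  then have "\<And>b d :: 'a. b = d" by (metis UNIV_I singletonD)
  then show ?thesis using assms(2) by (auto intro: nth_equalityI)
qed

text \<open>Drop the last letter of a nonempty trace and put \<open>a\<close> in front: over one
  action this is the same word again.\<close>

lemma weak_traces_Prefix_Act_superset:
  fixes p :: "('a, 'v) bccs"
  assumes "CARD('a) = 1"
  shows "weak_traces p \<subseteq> weak_traces (Prefix (Act a) p)"
proof
  fix w assume w: "w \<in> weak_traces p"
  show "w \<in> weak_traces (Prefix (Act a) p)"
  proof (cases w)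
    case Nil
    then show ?thesis by (simp add: Nil_in_weak_traces)
  next
    case (Cons b v)
    then have "length w = length (v @ [a])" "length w = length (a # v)" by simp_all
    then have "w = v @ [a]" "w = a # v" by (blast intro: list_eq_if_card_1[OF assms])+
    obtain s' where "weak_steps p (v @ [a]) s'"
      using w unfolding \<open>w = v @ [a]\<close> weak_traces_def by blast
    then obtain s where "weak_steps p v s" using weak_steps_append by blast
    then show ?thesis
      using \<open>w = a # v\<close> by (auto simp: weak_traces_def weak_steps_Prefix_Act)
  qed
qed

text \<open>Nonempty runs of the first summand are runs of the sum. The leading visible action keeps
  the empty run at its start and makes the condition on initial \<open>Tau\<close> steps
  vacuous.\<close>

lemma wif_act_pow_Plus:
  fixes t :: "('a, 'v) bccs"
  assumes "CARD('a) = 1"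
  shows "wif (act_pow a (Suc m) t) (Plus (act_pow a (Suc m) t) t)"
  unfolding wif_def
proof (intro allI impI)
  fix \<sigma> :: "'v \<Rightarrow> ('a, 'v) bccs"
  define p where "p = subst \<sigma> t"
  define q where "q = act_pow a (Suc m) p"
  have q: "q = Prefix (Act a) (act_pow a m p)" by (simp add: q_def)
  have "weak_traces p \<subseteq> weak_traces (act_pow a k p)" for k
    using weak_traces_Prefix_Act_superset[OF assms] by (induction k) fastforce+
  then have traces: "weak_traces (Plus q p) = weak_traces q"
    unfolding weak_traces_Plus q_def by blast
  have "(w, B) \<in> weak_impossible_futures (Plus q p)"
    if "(w, B) \<in> weak_impossible_futures q" for w B
  proof -
    obtain s where s: "weak_steps q w s" "weak_traces s \<inter> B = {}"
      using \<open>(w, B) \<in> weak_impossible_futures q\<close> by (auto simp: weak_impossible_futures_def)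
    show ?thesis
    proof (cases "w = []")
      \<comment> \<open>The sum answers by staying put: \<open>p\<close> adds no weak trace to
        \<open>q\<close>, so the same futures are impossible.\<close>
      case True
      then have "s = q" using s(1) by (simp add: q tau_steps_Prefix_Act)
      then show ?thesis
        using True s(2) traces tau_steps_refl by (fastforce simp: weak_impossible_futures_def)
    next
      case False
      then show ?thesis using s by (auto simp: weak_impossible_futures_def weak_steps_Plus)
    qed
  qed
  moreover have "\<not> step q Tau s" for s by (simp add: q step_Prefix_iff)
  ultimately have "wif_closed q (Plus q p)" using traces by (auto simp: wif_closed_def)
  then show "wif_closed (subst \<sigma> (act_pow a (Suc m) t))
      (subst \<sigma> (Plus (act_pow a (Suc m) t) t))"
    unfolding q_def p_def by (simp only: subst_act_pow subst.simps)
qed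

lemma closed_term_subst: "closed_subst \<sigma> \<Longrightarrow> closed_term (subst \<sigma> t)"
  unfolding closed_term_def closed_subst_def by (induction t) auto

lemma subst_Var: "subst Var t = t"
  by (induction t) auto

theorem theorem6p14:
  assumes "CARD('a) = 1"
  shows "\<not> (\<exists>E :: ('a, nat) axioms.
               finite E \<and> sound E \<and> ground_complete E \<and> omega_complete E)"
proof
  assume "\<exists>E :: ('a, nat) axioms.
    finite E \<and> sound E \<and> ground_complete E \<and> omega_complete E"
  then obtain E :: "('a, nat) axioms" where E: "finite E" "sound E"
    and complete: "ground_complete E" "omega_complete E" by blast
  \<comment> \<open>Closed instances of a valid inequation are derivable by ground-completeness, and
    \<open>\<omega>\<close>-completeness lifts this to open terms.\<close>
  have derivable: "derivable E t u" if "wif t u" for t u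
    using complete that closed_term_subst
    unfolding ground_complete_def omega_complete_def wif_def by blast
  have "finite ((\<lambda>e. size (fst e)) ` E)" using E(1) by simp
  then obtain m where m: "\<And>e. e \<in> E \<Longrightarrow> size (fst e) < m"
    unfolding finite_nat_set_iff_bounded by blast
  fix a :: 'a and x :: nat
  \<comment> \<open>The exponent \<open>Suc m\<close> is positive, as validity demands, and lies
    just outside the gap \<open>{1..<Suc m}\<close>.\<close>
  let ?t = "act_pow a (Suc m) (Var x) :: ('a, nat) bccs"
  have "0 \<in> levels x (subst Var ?t)"
  proof (rule derivable_level_zero[OF derivable[OF wif_act_pow_Plus[OF assms]] E(2)])
    show "size l < Suc m" if "(l, r) \<in> E" for l r using m[OF that] by simp
  qed (simp_all only: subst_Var levels.simps levels_act_pow, auto)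
  then show False by (simp only: subst_Var levels_act_pow) auto
qed

end
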